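(* Let $A=\{\mathbf a_1,\ldots,\mathbf a_m\}\subset\mathbb Z^n$ be a vector configuration such that $\mathbb NA$ is pointed, and let $I_A\subset K[x_1,\ldots,x_m]$ be its toric ideal. If $I_A$ is a generic toric ideal, then $\nu(I_A)=1$ and $I_A$ is generated by its indispensable binomials.
   Context: $K$ is a field. $\mathbb NA=\{l_1\mathbf a_1+\cdots+l_m\mathbf a_m : l_i\in\mathbb N\}$ with $0\in\mathbb N$; $\mathbb NA$ is pointed if zero is its only invertible element. The $A$-degree of $\mathbf x^{\mathbf u}=x_1^{u_1}\cdots x_m^{u_m}$ is $\deg_A(\mathbf x^{\mathbf u})=u_1\mathbf a_1+\cdots+u_m\mathbf a_m$. The toric ideal $I_A$ is the ideal generated by all binomials $\mathbf x^{\mathbf u}-\mathbf x^{\mathbf v}$ with $\deg_A(\mathbf x^{\mathbf u})=\deg_A(\mathbf x^{\mathbf v})$. For $\mathbf u\in\mathbb N^m$, $\operatorname{supp}(\mathbf u)=\{i: u_i\ne0\}$. $I_A$ is generic if it is minimally generated by binomials with full support, i.e. $I_A=(\mathbf x^{\mathbf u_1}-\mathbf x^{\mathbf v_1},\ldots,\mathbf x^{\mathbf u_r}-\mathbf x^{\mathbf v_r})$, a minimal generating set, with $\operatorname{supp}(\mathbf u_i)\cup\operatorname{supp}(\mathbf v_i)=\{1,\ldots,m\}$ for every $i\in\{1,\ldots,r\}$. $\nu(I_A)$ is the number of different minimal systems of binomial generators of $I_A$ (minimal: no proper subset generates $I_A$), where the sign of a binomial does not count. A binomial $B\in I_A$ is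 indispensable if every system of binomial generators of $I_A$ contains $B$ or $-B$.
   Formalization: The configuration is additionally assumed to contain a nonzero vector; this excludes A = {0}, where I_A = (x − 1) is generic but {x − 1} and {x² − 1, x³ − 1} are both minimal systems of binomial generators, so the claim fails. *)

theory Defs
  imports "HOL-Analysis.Finite_Cartesian_Product" "HOL-Analysis.Cartesian_Space"
    "HOL-Library.Poly_Mapping"
begin

text \<open>
  Exponent vectors and polynomials over the variables \<open>x\<^sub>i\<close>, where \<open>i\<close> ranges over the finite
  type \<open>'m\<close>, so that \<open>m\<close> is \<open>CARD('m)\<close>. A vector configuration is a family
  \<open>a :: 'm \<Rightarrow> int ^ 'n\<close>; repetitions are not excluded.
\<close>

type_synonym 'm expo = "'m \<Rightarrow>\<^sub>0 nat"
type_synonym ('m, 'k) mpoly = "'m expo \<Rightarrow>\<^sub>0 'k"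

definition monomial :: "'m expo \<Rightarrow> ('m, 'k::field) mpoly" where
  "monomial u = Poly_Mapping.single u 1"

definition nat_comb :: "('m::finite \<Rightarrow> int ^ 'n) \<Rightarrow> ('m \<Rightarrow> nat) \<Rightarrow> int ^ 'n" where
  "nat_comb a l = (\<Sum>i\<in>UNIV. int (l i) *s a i)"

definition semigroup_of :: "('m::finite \<Rightarrow> int ^ 'n) \<Rightarrow> (int ^ 'n) set" where
  "semigroup_of a = {nat_comb a l | l. True}"

definition pointed :: "('a::monoid_add) set \<Rightarrow> bool" where
  "pointed M \<longleftrightarrow> (\<forall>x\<in>M. \<forall>y\<in>M. x + y = 0 \<longrightarrow> x = 0)"

definition deg_A :: "('m::finite \<Rightarrow> int ^ 'n) \<Rightarrow> 'm expo \<Rightarrow> int ^ 'n" where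
  "deg_A a u = nat_comb a (Poly_Mapping.lookup u)"

text \<open>The ideal generated by a set is its span in the ring viewed as a module over itself.\<close>

lemma module_times: "module ((*) :: 'a::comm_ring_1 \<Rightarrow> 'a \<Rightarrow> 'a)"
  by unfold_locales (simp_all add: algebra_simps)

abbreviation ideal_gen :: "'a::comm_ring_1 set \<Rightarrow> 'a set" where
  "ideal_gen \<equiv> module.span (*)"

definition toric_ideal :: "('m::finite \<Rightarrow> int ^ 'n) \<Rightarrow> ('m, 'k::field) mpoly set" where
  "toric_ideal a = ideal_gen {monomial u - monomial v | u v. deg_A a u = deg_A a v}"

definition minimal_generating_set :: "'a::comm_ring_1 set \<Rightarrow> 'a set \<Rightarrow> bool" where
  "minimal_generating_set I S \<longleftrightarrow> ideal_gen S = I \<and> (\<forall>T. T \<subset> S \<longrightarrow> ideal_gen T \<noteq> I)"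

text \<open>Binomials are pure differences of two distinct monomials, both with coefficient one.\<close>

definition is_binomial :: "('m, 'k::field) mpoly \<Rightarrow> bool" where
  "is_binomial B \<longleftrightarrow> (\<exists>u v. u \<noteq> v \<and> B = monomial u - monomial v)"

definition full_support_binomial :: "('m, 'k::field) mpoly \<Rightarrow> bool" where
  "full_support_binomial B \<longleftrightarrow>
    (\<exists>u v. u \<noteq> v \<and> B = monomial u - monomial v \<and> Poly_Mapping.keys u \<union> Poly_Mapping.keys v = UNIV)"

definition generic :: "('m, 'k::field) mpoly set \<Rightarrow> bool" where
  "generic I \<longleftrightarrow>
    (\<exists>S. finite S \<and> minimal_generating_set I S \<and> (\<forall>B\<in>S. full_support_binomial B))"

definition binomial_generating_system ::
    "('m, 'k::field) mpoly set \<Rightarrow> ('m, 'k) mpoly set \<Rightarrow> bool" where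
  "binomial_generating_system I S \<longleftrightarrow> (\<forall>B\<in>S. is_binomial B) \<and> ideal_gen S = I"

text \<open>
  Forgetting signs turns a system \<open>S\<close> into the set of classes \<open>{B, -B}\<close> with \<open>B \<in> S\<close>. As \<open>card\<close>
  sends infinite sets to 0, an infinite number of minimal systems is reported as 0; the
  value 1 does mean that there is exactly one.
\<close>

definition up_to_sign :: "'a::uminus set \<Rightarrow> 'a set set" where
  "up_to_sign S = (\<lambda>B. {B, - B}) ` S"

definition nu :: "('m, 'k::field) mpoly set \<Rightarrow> nat" where
  "nu I = card (up_to_sign `
    {S. binomial_generating_system I S \<and> minimal_generating_set I S})"

definition indispensable :: "('m, 'k::field) mpoly set \<Rightarrow> ('m, 'k) mpoly \<Rightarrow> bool" where
  "indispensable I B \<longleftrightarrow> is_binomial B \<and> B \<in> I \<and>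
    (\<forall>S. binomial_generating_system I S \<longrightarrow> B \<in> S \<or> - B \<in> S)"

end

theory Submission imports Defs begin

text \<open>
  A set of binomials generates \<open>I\<^sub>A\<close> iff its moves \<open>w + p \<rightarrow> w + q\<close> connect every fiber of
  \<open>deg\<^sub>A\<close>. Let \<open>B = x\<^sup>u - x\<^sup>v\<close> belong to a minimal generating set \<open>S\<close> of full support. If two
  points of the fiber of \<open>B\<close> share a variable, cancelling it puts them in a smaller fiber, so
  they are connected without \<open>B\<close>. The first move on that path has full support, so every
  point of the fiber of \<open>B\<close> shares a variable with one of its two ends; hence \<open>u\<close> and \<open>v\<close> are
  connected without \<open>B\<close>, against minimality. So distinct points of the fiber have disjoint
  supports, and since \<open>u\<close> and \<open>v\<close> together use all variables the fiber is \<open>{u, v}\<close>. Any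
  binomial generating system must then contain \<open>B\<close> up to sign.
\<close>

section \<open>Generated ideals and the exponents of a binomial\<close>

lemmas ideal_base = module.span_base[OF module_times]
  and ideal_zero = module.span_zero[OF module_times]
  and ideal_add = module.span_add[OF module_times]
  and ideal_neg = module.span_neg[OF module_times]
  and ideal_scale = module.span_scale[OF module_times]
  and ideal_minimal = module.span_minimal[OF module_times]
  and ideal_subspace = module.subspace_span[OF module_times]
  and ideal_induct_alt = module.span_induct_alt[OF module_times, consumes 1, case_names base step]

lemma ideal_gen_eqI:
  assumes "S \<subseteq> ideal_gen T" and "T \<subseteq> ideal_gen S"
  shows "ideal_gen S = ideal_gen T"
  using assms ideal_minimal ideal_subspace by (metis subset_antisym)

lemma monomial_mult: "monomial u * monomial v = (monomial (u + v) :: ('m, 'k::field) mpoly)"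
  by (simp add: monomial_def mult_single)

lemma keys_binomial:
  assumes "u \<noteq> v"
  shows "Poly_Mapping.keys (monomial u - monomial v :: ('m, 'k::field) mpoly) = {u, v}"
  using assms by (auto simp: monomial_def in_keys_iff lookup_minus lookup_single when_def split: if_splits)

text \<open>The coefficients 1 and -1 are nonzero in every field, so the keys of a binomial are
  exactly its two exponents. Only the unordered pair is recovered: the sign is free, and in
  characteristic 2 a binomial equals its negative.\<close>

lemma binomial_up_to_sign_unique:
  assumes "u \<noteq> v" "p \<noteq> q"
    and "monomial p - monomial q = (B :: ('m, 'k::field) mpoly) \<or> monomial q - monomial p = B"
    and "B = monomial u - monomial v"
  shows "{p, q} = {u, v}"
  using assms keys_binomial[of u v, where 'k='k] keys_binomial[of p q, where 'k='k]
    keys_binomial[of q p, where 'k='k] by auto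

section \<open>Coefficient sums over classes of exponents\<close>

definition coeff_sum :: "('b \<Rightarrow> bool) \<Rightarrow> ('b \<Rightarrow>\<^sub>0 'k::ab_group_add) \<Rightarrow> 'k" where
  "coeff_sum P f = (\<Sum>w\<in>Poly_Mapping.keys f. Poly_Mapping.lookup f w when P w)"

lemma coeff_sum_superset:
  assumes "finite A" "Poly_Mapping.keys f \<subseteq> A"
  shows "coeff_sum P f = (\<Sum>w\<in>A. Poly_Mapping.lookup f w when P w)"
  unfolding coeff_sum_def
  by (rule sum.mono_neutral_left) (use assms in \<open>auto simp: in_keys_iff\<close>)

lemma coeff_sum_add: "coeff_sum P (f + g) = coeff_sum P f + coeff_sum P g"
proof -
  let ?A = "Poly_Mapping.keys f \<union> Poly_Mapping.keys g"
  have "coeff_sum P (f + g) = (\<Sum>w\<in>?A. Poly_Mapping.lookup (f + g) w when P w)"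
    by (intro coeff_sum_superset Poly_Mapping.keys_add) simp
  moreover have "coeff_sum P f = (\<Sum>w\<in>?A. Poly_Mapping.lookup f w when P w)"
    by (rule coeff_sum_superset) auto
  moreover have "coeff_sum P g = (\<Sum>w\<in>?A. Poly_Mapping.lookup g w when P w)"
    by (rule coeff_sum_superset) auto
  ultimately show ?thesis
    by (simp add: lookup_add when_add_distrib sum.distrib)
qed

lemma coeff_sum_zero: "coeff_sum P 0 = 0"
  by (simp add: coeff_sum_def)

lemma coeff_sum_single: "coeff_sum P (Poly_Mapping.single w c) = (c when P w)"
  by (subst coeff_sum_superset[where A="{w}"]) auto

lemma coeff_sum_diff: "coeff_sum P (f - g) = coeff_sum P f - coeff_sum P g"
  using coeff_sum_add[of P "f - g" g] by simp

text \<open>Each term of \<open>f\<close> with exponent \<open>k\<close> contributes opposite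
  coefficients at \<open>k + p\<close> and \<open>k + q\<close>, and \<open>P\<close> selects both
  or neither.\<close>

lemma coeff_sum_mult_binomial:
  fixes f :: "('m, 'k::field) mpoly"
  assumes "\<And>w. P (w + p) \<longleftrightarrow> P (w + q)"
  shows "coeff_sum P (f * (monomial p - monomial q)) = 0"
proof (induction f rule: update_induct)
  case const
  show ?case by (simp add: coeff_sum_zero)
next
  case (update f k c)
  have "Poly_Mapping.update k c f = f + Poly_Mapping.single k c"
    using update(1) by (intro poly_mapping_eqI)
      (auto simp: lookup_update lookup_add lookup_single in_keys_iff)
  moreover have "coeff_sum P (Poly_Mapping.single k c * (monomial p - monomial q)) = 0"
    by (simp add: monomial_def right_diff_distrib mult_single coeff_sum_diff coeff_sum_single assms)
  ultimately show ?case
    using update(3) by (simp add: distrib_right coeff_sum_add)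
qed

text \<open>Summing the coefficients over the \<open>R\<close>-class of \<open>u\<close> is additive
  and kills every multiple of a generator, hence the whole ideal. On the given binomial the sum is 1
  minus the indicator of \<open>R u v\<close>. The lemma serves for two congruences: connectedness
  by moves and equality of degrees.\<close>

lemma binomial_ideal_congruence:
  fixes T :: "('m, 'k::field) mpoly set"
  assumes gen: "\<And>B. B \<in> T \<Longrightarrow> \<exists>p q. B = monomial p - monomial q \<and> R p q"
    and "equivp R" and shift: "\<And>w p q. R p q \<Longrightarrow> R (w + p) (w + q)"
    and mem: "monomial u - monomial v \<in> ideal_gen T"
  shows "R u v"
proof -
  have "coeff_sum (R u) f = 0" if "f \<in> ideal_gen T" for f
    using that
  proof (induction rule: ideal_induct_alt)
    case base
    show ?case by (rule coeff_sum_zero)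
  next
    case (step c x y)
    obtain p q where "x = monomial p - monomial q" "R p q"
      using gen step(1) by blast
    moreover have "R u (w + p) \<longleftrightarrow> R u (w + q)" for w
      using \<open>R p q\<close> shift \<open>equivp R\<close> by (meson equivp_symp equivp_transp)
    ultimately show ?case
      using step by (simp add: coeff_sum_add coeff_sum_mult_binomial)
  qed
  then have "(1 when R u u) - (1 when R u v) = (0::'k)"
    using mem by (force simp: monomial_def coeff_sum_diff coeff_sum_single)
  then show ?thesis
    using \<open>equivp R\<close> by (auto simp: equivp_reflp when_def split: if_splits)
qed

section \<open>Connectedness of exponents by binomial moves\<close>

definition moves :: "('m, 'k::field) mpoly set \<Rightarrow> ('m expo \<times> 'm expo) set" where
  "moves T = {(w + p, w + q) | w p q.
    p \<noteq> q \<and> (monomial p - monomial q \<in> T \<or> monomial q - monomial p \<in> T)}"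

lemma movesI:
  "p \<noteq> q \<Longrightarrow> monomial p - monomial q \<in> T \<or> monomial q - monomial p \<in> T
    \<Longrightarrow> (w + p, w + q) \<in> moves T"
  unfolding moves_def by blast

lemma movesE:
  assumes "(y, z) \<in> moves T"
  obtains w p q where "y = w + p" "z = w + q" "p \<noteq> q"
    "monomial p - monomial q \<in> T \<or> monomial q - monomial p \<in> T"
  using assms unfolding moves_def by blast

lemma sym_moves: "sym (moves T)"
  by (rule symI) (auto elim!: movesE intro!: movesI)

lemma connected_sym: "(y, z) \<in> (moves T)\<^sup>* \<Longrightarrow> (z, y) \<in> (moves T)\<^sup>*"
  using sym_rtrancl[OF sym_moves] by (rule symD)

lemma connected_shift: "(y, z) \<in> (moves T)\<^sup>* \<Longrightarrow> (c + y, c + z) \<in> (moves T)\<^sup>*"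
proof (induction rule: rtrancl_induct)
  case base
  show ?case by simp
next
  case (step y z)
  obtain w p q where yz: "y = w + p" "z = w + q" "p \<noteq> q"
    and pq: "monomial p - monomial q \<in> T \<or> monomial q - monomial p \<in> T"
    using step(2) by (rule movesE)
  have "(c + y, c + z) \<in> moves T"
    using movesI[OF yz(3) pq, of "c + w"] by (simp add: yz add.assoc)
  then show ?case
    using step by (meson rtrancl.rtrancl_into_rtrancl)
qed

text \<open>Both orientations of a binomial are moves, so connectedness is an equivalence; it is
  stable under translation, and each generator is itself a move with shift 0. So it is a congruence
  of the required kind.\<close>

lemma connected_if_in_ideal:
  fixes T :: "('m, 'k::field) mpoly set"
  assumes T: "\<forall>B\<in>T. is_binomial B" and mem: "monomial u - monomial v \<in> ideal_gen T"
  shows "(u, v) \<in> (moves T)\<^sup>*"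
proof (rule binomial_ideal_congruence[OF _ _ _ mem])
  fix B assume "B \<in> T"
  then obtain p q where "p \<noteq> q" "B = monomial p - monomial q"
    using T unfolding is_binomial_def by blast
  moreover from this have "(p, q) \<in> moves T"
    using movesI[of p q T 0] \<open>B \<in> T\<close> by simp
  ultimately show "\<exists>p q. B = monomial p - monomial q \<and> (p, q) \<in> (moves T)\<^sup>*"
    by blast
next
  show "equivp (\<lambda>u v. (u, v) \<in> (moves T)\<^sup>*)"
    by (rule equivpI) (auto simp: reflp_def symp_def transp_def intro: connected_sym)
qed (rule connected_shift)

text \<open>Along a path the differences of consecutive monomials telescope, and each is a monomial
  multiple of a generator up to sign.\<close>

lemma in_ideal_if_connected:
  fixes T :: "('m, 'k::field) mpoly set"
  assumes "(u, v) \<in> (moves T)\<^sup>*"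
  shows "monomial u - monomial v \<in> ideal_gen T"
  using assms
proof (induction rule: rtrancl_induct)
  case base
  show ?case by (simp add: ideal_zero)
next
  case (step y z)
  obtain w p q where yz: "y = w + p" "z = w + q"
    and "monomial p - monomial q \<in> T \<or> monomial q - monomial p \<in> T"
    using step(2) by (rule movesE)
  then have "monomial p - monomial q \<in> ideal_gen T"
    using ideal_base ideal_neg minus_diff_eq by metis
  then have "monomial w * (monomial p - monomial q) \<in> ideal_gen T"
    by (rule ideal_scale)
  then have "monomial y - monomial z \<in> ideal_gen T"
    by (simp add: yz right_diff_distrib monomial_mult)
  then have "(monomial u - monomial y) + (monomial y - monomial z) \<in> ideal_gen T"
    using step.IH by (rule ideal_add[rotated])
  then show ?case by simp
qed

section \<open>Degrees, pointedness and membership in the toric ideal\<close>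

lemma deg_A_add: "deg_A a (u + v) = deg_A a u + deg_A a v"
  by (simp add: deg_A_def nat_comb_def lookup_add vector_sadd_rdistrib sum.distrib)

lemma deg_A_zero: "deg_A a 0 = 0"
  by (simp add: deg_A_def nat_comb_def)

lemma deg_A_single: "deg_A a (Poly_Mapping.single i 1) = a i"
proof -
  have "int (Poly_Mapping.lookup (Poly_Mapping.single i 1) j) *s a j = (if j = i then a i else 0)" for j
    by (auto simp: lookup_single)
  then show ?thesis by (simp add: deg_A_def nat_comb_def)
qed

lemma deg_A_in_semigroup: "deg_A a u \<in> semigroup_of a"
  by (auto simp: deg_A_def semigroup_of_def)

lemma expo_split:
  fixes u :: "'m expo"
  assumes "i \<in> Poly_Mapping.keys u"
  obtains u' where "u = Poly_Mapping.single i 1 + u'"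
proof
  \<comment> \<open>The truncated subtraction is exact because the exponent at \<open>i\<close> is
    at least 1.\<close>
  show "u = Poly_Mapping.single i 1 + (u - Poly_Mapping.single i 1)"
    using assms by (intro poly_mapping_eqI)
      (auto simp: lookup_add lookup_minus lookup_single when_def in_keys_iff)
qed

lemma keys_add_expo:
  fixes u v :: "'m expo"
  shows "Poly_Mapping.keys (u + v) = Poly_Mapping.keys u \<union> Poly_Mapping.keys v"
  by (auto simp: in_keys_iff lookup_add)

text \<open>Splitting off one variable writes 0 as \<open>a i\<close> plus another degree, so
  \<open>a i\<close> is invertible in the semigroup.\<close>

lemma pointed_deg_A_zero:
  assumes "pointed (semigroup_of a)" "deg_A a u = 0" "i \<in> Poly_Mapping.keys u"
  shows "a i = 0"
proof -
  obtain u' where "u = Poly_Mapping.single i 1 + u'"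
    using assms(3) by (rule expo_split)
  then have "a i + deg_A a u' = 0"
    using assms(2) by (simp add: deg_A_add deg_A_single del: One_nat_def)
  moreover have "a i \<in> semigroup_of a"
    by (metis deg_A_in_semigroup deg_A_single)
  ultimately show ?thesis
    using assms(1) deg_A_in_semigroup unfolding pointed_def by blast
qed

lemma binomial_in_toric_ideal_iff:
  "monomial u - monomial v \<in> (toric_ideal a :: ('m::finite, 'k::field) mpoly set)
    \<longleftrightarrow> deg_A a u = deg_A a v"
proof
  assume "monomial u - monomial v \<in> (toric_ideal a :: ('m, 'k) mpoly set)"
  then show "deg_A a u = deg_A a v"
    unfolding toric_ideal_def
    by (rule binomial_ideal_congruence[where R="\<lambda>u v. deg_A a u = deg_A a v", rotated 3])
      (auto intro!: equivpI simp: reflp_def symp_def transp_def deg_A_add)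
next
  assume "deg_A a u = deg_A a v"
  then show "monomial u - monomial v \<in> (toric_ideal a :: ('m, 'k) mpoly set)"
    unfolding toric_ideal_def by (intro ideal_base) blast
qed

section \<open>Indispensability of full-support generators\<close>

lemma full_support_keys:
  fixes S :: "('m, 'k::field) mpoly set"
  assumes "\<forall>B\<in>S. full_support_binomial B" "p \<noteq> q"
    and "monomial p - monomial q \<in> S \<or> monomial q - monomial p \<in> S"
  shows "Poly_Mapping.keys p \<union> Poly_Mapping.keys q = UNIV"
proof -
  obtain B where B: "monomial p - monomial q = B \<or> monomial q - monomial p = B" "B \<in> S"
    using assms(3) by blast
  then obtain u v where "u \<noteq> v" "B = monomial u - monomial v"
    and keys: "Poly_Mapping.keys u \<union> Poly_Mapping.keys v = UNIV"
    using assms(1) unfolding full_support_binomial_def by blast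
  \<comment> \<open>The representation witnessing full support may list the exponents in the other
    order; the union of supports depends only on the pair.\<close>
  then have "{p, q} = {u, v}"
    using binomial_up_to_sign_unique assms(2) B(1) by metis
  then show ?thesis
    using keys by (auto simp: doubleton_eq_iff)
qed

text \<open>A path from \<open>u\<close> to \<open>v\<close> by moves of \<open>T\<close> must begin
  with a move from \<open>u\<close> to \<open>v\<close>, the only other point of the fiber. Its
  shift divides both monomials, so disjoint supports make it 0 and the move is the binomial
  itself.\<close>

lemma indispensable_if_isolated_fiber:
  fixes a :: "'m::finite \<Rightarrow> int ^ 'n"
  assumes "u \<noteq> v" and deg: "deg_A a u = deg_A a v"
    and fiber: "\<And>z. deg_A a z = deg_A a u \<Longrightarrow> z = u \<or> z = v"
    and disj: "Poly_Mapping.keys u \<inter> Poly_Mapping.keys v = {}"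
  shows "indispensable (toric_ideal a) (monomial u - monomial v :: ('m, 'k::field) mpoly)"
  unfolding indispensable_def
proof (intro conjI allI impI)
  show "is_binomial (monomial u - monomial v :: ('m, 'k) mpoly)"
    using \<open>u \<noteq> v\<close> unfolding is_binomial_def by blast
  show mem: "monomial u - monomial v \<in> (toric_ideal a :: ('m, 'k) mpoly set)"
    using deg by (simp add: binomial_in_toric_ideal_iff)
  fix T :: "('m, 'k) mpoly set"
  assume T: "binomial_generating_system (toric_ideal a) T"
  then have "(u, v) \<in> (moves T)\<^sup>*"
    using mem unfolding binomial_generating_system_def by (intro connected_if_in_ideal) auto
  then obtain y where "(u, y) \<in> moves T"
    using \<open>u \<noteq> v\<close> by (metis converse_rtranclE)
  then obtain w p q where uy: "u = w + p" "y = w + q" "p \<noteq> q"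
    and pq: "monomial p - monomial q \<in> T \<or> monomial q - monomial p \<in> T"
    by (rule movesE)
  have "deg_A a p = deg_A a q"
    using pq T ideal_base[of _ T] binomial_in_toric_ideal_iff[where 'k='k]
    unfolding binomial_generating_system_def by metis
  \<comment> \<open>The move preserves the degree, and \<open>p \<noteq> q\<close> rules out
    \<open>y = u\<close>.\<close>
  then have "y = v"
    using fiber[of y] uy by (auto simp: deg_A_add)
  then have "Poly_Mapping.keys w \<subseteq> Poly_Mapping.keys u \<inter> Poly_Mapping.keys v"
    using uy by (auto simp: keys_add_expo)
  then have "w = 0"
    using disj by (metis keys_eq_empty subset_empty)
  then show "monomial u - monomial v \<in> T \<or> - (monomial u - monomial v) \<in> T"
    using pq uy \<open>y = v\<close> by simp
qed

text \<open>If \<open>a i = 0\<close>, then 1 and the \<open>i\<close>-th variable have equal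
  degree, so some move leaves exponent 0. It comes from a generator with one exponent 0 and the
  other of full support and degree 0, and pointedness makes all vectors vanish.\<close>

lemma generic_vectors_nonzero:
  fixes a :: "'m::finite \<Rightarrow> int ^ 'n" and S :: "('m, 'k::field) mpoly set"
  assumes pointed: "pointed (semigroup_of a)" and nz: "\<exists>i. a i \<noteq> 0"
    and gen: "ideal_gen S = toric_ideal a" and full: "\<forall>B\<in>S. full_support_binomial B"
  shows "a i \<noteq> 0"
proof
  assume "a i = 0"
  have bin: "\<forall>B\<in>S. is_binomial B"
    using full unfolding full_support_binomial_def is_binomial_def by blast
  have "monomial 0 - monomial (Poly_Mapping.single i 1) \<in> ideal_gen S"
    using \<open>a i = 0\<close>
    by (simp add: gen binomial_in_toric_ideal_iff deg_A_zero deg_A_single del: One_nat_def)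
  then have "(0, Poly_Mapping.single i 1) \<in> (moves S)\<^sup>*"
    using bin by (intro connected_if_in_ideal)
  moreover have "0 \<noteq> (Poly_Mapping.single i 1 :: 'm expo)"
    by (metis lookup_single_eq lookup_zero zero_neq_one)
  ultimately obtain y where "(0, y) \<in> moves S"
    by (metis converse_rtranclE)
  then obtain w p q where wpq: "0 = w + p" "p \<noteq> q"
    and pq: "monomial p - monomial q \<in> S \<or> monomial q - monomial p \<in> S"
    by (rule movesE)
  have "Poly_Mapping.keys (w + p) = {}"
    using wpq(1) by (metis keys_zero)
  then have "p = 0"
    by (simp add: keys_add_expo)
  have "Poly_Mapping.keys q = UNIV"
    using full_support_keys[OF full wpq(2) pq] \<open>p = 0\<close> by simp
  moreover have "deg_A a p = deg_A a q"
    using pq gen ideal_base[of _ S] binomial_in_toric_ideal_iff[where 'k='k] by metis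
  then have "deg_A a q = 0"
    using \<open>p = 0\<close> by (simp add: deg_A_zero)
  ultimately show False
    using pointed_deg_A_zero[OF pointed] nz by blast
qed

lemma generic_generator_indispensable:
  fixes a :: "'m::finite \<Rightarrow> int ^ 'n" and S :: "('m, 'k::field) mpoly set"
  assumes pointed: "pointed (semigroup_of a)" and nz: "\<exists>i. a i \<noteq> 0"
    and min: "minimal_generating_set (toric_ideal a) S"
    and full: "\<forall>B\<in>S. full_support_binomial B" and "B \<in> S"
  shows "indispensable (toric_ideal a) B"
proof -
  have gen: "ideal_gen S = toric_ideal a"
    using min unfolding minimal_generating_set_def by blast
  have bin: "\<forall>B\<in>S. is_binomial B"
    using full unfolding full_support_binomial_def is_binomial_def by blast
  have a_nz: "a i \<noteq> 0" for i
    by (rule generic_vectors_nonzero[OF pointed nz gen full])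
  obtain u v where "u \<noteq> v" and B: "B = monomial u - monomial v"
    and uv: "Poly_Mapping.keys u \<union> Poly_Mapping.keys v = UNIV"
    using full \<open>B \<in> S\<close> unfolding full_support_binomial_def by blast
  have deg_S: "deg_A a p = deg_A a q"
    if "monomial p - monomial q \<in> S \<or> monomial q - monomial p \<in> S" for p q
    using that gen ideal_base[of _ S] binomial_in_toric_ideal_iff[where 'k='k] by metis
  have deg: "deg_A a u = deg_A a v"
    using deg_S \<open>B \<in> S\<close> B by blast
  \<comment> \<open>If one exponent were 0, the other would have full support and degree 0, forcing
    every \<open>a i\<close> to vanish.\<close>
  have "u \<noteq> 0" "v \<noteq> 0"
    using uv deg pointed_deg_A_zero[OF pointed] a_nz
    by (metis Un_empty_left Un_empty_right UNIV_I deg_A_zero keys_zero)+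

  define S' where "S' = S - {B}"
  have not_connected: "(u, v) \<notin> (moves S')\<^sup>*"
  proof
    assume "(u, v) \<in> (moves S')\<^sup>*"
    then have "B \<in> ideal_gen S'"
      unfolding B by (rule in_ideal_if_connected)
    then have "S \<subseteq> ideal_gen S'" "S' \<subseteq> ideal_gen S"
      unfolding S'_def by (auto intro: ideal_base)
    then have "ideal_gen S' = toric_ideal a"
      using ideal_gen_eqI gen by metis
    moreover have "S' \<subset> S"
      using \<open>B \<in> S\<close> unfolding S'_def by blast
    ultimately show False
      using min unfolding minimal_generating_set_def by blast
  qed

  \<comment> \<open>The fiber of \<open>p\<close> lies below that of \<open>u\<close> by the degree
    of \<open>c\<close>. Applying \<open>B\<close> there with shift \<open>w\<close> would make the
    degrees of \<open>c\<close> and \<open>w\<close> add up to 0, which pointedness and nonzero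
    vectors exclude.\<close>
  have lower: "(p, q) \<in> (moves S')\<^sup>*"
    if "c \<noteq> 0" "deg_A a (c + p) = deg_A a u" "deg_A a p = deg_A a q" for c p q
  proof -
    have "(p, q) \<in> (moves S)\<^sup>*"
      using that(3) bin by (intro connected_if_in_ideal) (simp_all add: gen binomial_in_toric_ideal_iff)
    \<comment> \<open>The degree is carried along so that each intermediate point is known to lie in
      the fiber of \<open>p\<close>.\<close>
    then have "(p, q) \<in> (moves S')\<^sup>* \<and> deg_A a p = deg_A a q"
    proof (induction rule: rtrancl_induct)
      case base
      show ?case by simp
    next
      case (step y z)
      obtain w r s where yz: "y = w + r" "z = w + s" "r \<noteq> s"
        and rs: "monomial r - monomial s \<in> S \<or> monomial s - monomial r \<in> S"
        using step(2) by (rule movesE)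
      have "{r, s} \<noteq> {u, v}"
      proof
        assume "{r, s} = {u, v}"
        then have "deg_A a r = deg_A a u"
          using deg by (auto simp: doubleton_eq_iff)
        then have "deg_A a c + deg_A a w = 0"
          using that(2) step.IH yz(1) by (simp add: deg_A_add)
        then have "deg_A a c = 0"
          using pointed deg_A_in_semigroup unfolding pointed_def by blast
        then show False
          using pointed_deg_A_zero[OF pointed] a_nz \<open>c \<noteq> 0\<close> by (metis ex_in_conv keys_eq_empty)
      qed
      then have "monomial r - monomial s \<in> S' \<or> monomial s - monomial r \<in> S'"
        using rs binomial_up_to_sign_unique[OF \<open>u \<noteq> v\<close> yz(3) _ B] unfolding S'_def by blast
      then have "(y, z) \<in> moves S'"
        unfolding yz(1,2) by (rule movesI[OF yz(3)])
      moreover have "deg_A a y = deg_A a z"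
        using deg_S[OF rs] yz by (simp add: deg_A_add)
      ultimately show ?case
        using step.IH by (auto intro: rtrancl_into_rtrancl)
    qed
    then show ?thesis by blast
  qed

  \<comment> \<open>Cancel the common variable, connect the quotients by \<open>lower\<close>, and
    translate the path back.\<close>
  have share: "(y, z) \<in> (moves S')\<^sup>*"
    if i: "i \<in> Poly_Mapping.keys y" "i \<in> Poly_Mapping.keys z"
      and yz: "deg_A a y = deg_A a u" "deg_A a z = deg_A a u" for i y z
  proof -
    obtain p where p: "y = Poly_Mapping.single i 1 + p"
      using i(1) by (rule expo_split)
    obtain q where q: "z = Poly_Mapping.single i 1 + q"
      using i(2) by (rule expo_split)
    have "(p, q) \<in> (moves S')\<^sup>*"
    proof (rule lower)
      show "(Poly_Mapping.single i 1 :: 'm expo) \<noteq> 0"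
        by (metis lookup_single_eq lookup_zero zero_neq_one)
      show "deg_A a (Poly_Mapping.single i 1 + p) = deg_A a u"
        using yz(1) p by simp
      have "deg_A a y = deg_A a z"
        using yz by simp
      then show "deg_A a p = deg_A a q"
        unfolding p q deg_A_add by simp
    qed
    then show ?thesis
      unfolding p q by (rule connected_shift)
  qed

  have disjoint: "y = z"
    if i: "i \<in> Poly_Mapping.keys y" "i \<in> Poly_Mapping.keys z"
      and yz: "deg_A a y = deg_A a u" "deg_A a z = deg_A a u" for i y z
  proof (rule ccontr)
    assume "y \<noteq> z"
    then obtain y' where "(y, y') \<in> moves S'"
      using share[OF i yz] by (metis converse_rtranclE)
    then obtain w p q where y: "y = w + p" "y' = w + q" "p \<noteq> q"
      and pq: "monomial p - monomial q \<in> S' \<or> monomial q - monomial p \<in> S'"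
      by (rule movesE)
    then have pq_S: "monomial p - monomial q \<in> S \<or> monomial q - monomial p \<in> S"
      unfolding S'_def by blast
    have deg_y': "deg_A a y' = deg_A a u"
      using deg_S[OF pq_S] y yz(1) by (simp add: deg_A_add)
    \<comment> \<open>Translation by \<open>w\<close> only enlarges the supports of \<open>p\<close>
      and \<open>q\<close>.\<close>
    have "Poly_Mapping.keys y \<union> Poly_Mapping.keys y' = UNIV"
      using full_support_keys[OF full y(3) pq_S] y by (auto simp: keys_add_expo)
    then have y_connected: "(y, x) \<in> (moves S')\<^sup>*" if "x \<noteq> 0" "deg_A a x = deg_A a u" for x
    proof -
      obtain j where j: "j \<in> Poly_Mapping.keys x"
        using \<open>x \<noteq> 0\<close> by (metis ex_in_conv keys_eq_empty)
      consider "j \<in> Poly_Mapping.keys y" | "j \<in> Poly_Mapping.keys y'"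
        using \<open>Poly_Mapping.keys y \<union> Poly_Mapping.keys y' = UNIV\<close> by blast
      then show ?thesis
      proof cases
        case 1
        then show ?thesis by (rule share[OF _ j yz(1) that(2)])
      next
        case 2
        then have "(y', x) \<in> (moves S')\<^sup>*"
          by (rule share[OF _ j deg_y' that(2)])
        then show ?thesis
          using \<open>(y, y') \<in> moves S'\<close> by (rule converse_rtrancl_into_rtrancl[rotated])
      qed
    qed
    have "(u, v) \<in> (moves S')\<^sup>*"
      using connected_sym[OF y_connected[OF \<open>u \<noteq> 0\<close> refl]] y_connected[OF \<open>v \<noteq> 0\<close> deg[symmetric]]
      by (rule rtrancl_trans)
    then show False
      using not_connected by blast
  qed

  show ?thesis
    unfolding B
  proof (rule indispensable_if_isolated_fiber[OF \<open>u \<noteq> v\<close> deg])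
    show "Poly_Mapping.keys u \<inter> Poly_Mapping.keys v = {}"
      using disjoint[OF _ _ refl deg[symmetric]] \<open>u \<noteq> v\<close> by blast
    fix z assume z: "deg_A a z = deg_A a u"
    \<comment> \<open>This keeps 0 out of the fiber, so \<open>z\<close> contains a variable, which
      it must share with \<open>u\<close> or \<open>v\<close>.\<close>
    have "deg_A a u \<noteq> 0"
      using pointed_deg_A_zero[OF pointed, of u] a_nz \<open>u \<noteq> 0\<close> by (metis ex_in_conv keys_eq_empty)
    then have "z \<noteq> 0"
      using z deg_A_zero by metis
    then obtain i where "i \<in> Poly_Mapping.keys z"
      by (metis ex_in_conv keys_eq_empty)
    moreover have "i \<in> Poly_Mapping.keys u \<or> i \<in> Poly_Mapping.keys v"
      using uv by blast
    ultimately show "z = u \<or> z = v"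
      using disjoint[OF _ _ z refl] disjoint[OF _ _ z deg[symmetric]] by blast
  qed
qed

section \<open>Uniqueness of the minimal system\<close>

lemma minimal_system_of_indispensables_unique:
  fixes I :: "('m, 'k::field) mpoly set"
  assumes ind: "\<forall>B\<in>S. indispensable I B" and gen: "ideal_gen S = I"
    and T: "binomial_generating_system I T" "minimal_generating_set I T"
  shows "up_to_sign T = up_to_sign S"
proof -
  have in_T: "B \<in> T \<or> - B \<in> T" if "B \<in> S" for B
    using ind T(1) that unfolding indispensable_def by blast
  \<comment> \<open>\<open>T\<close> contains every element of \<open>S\<close> up to sign, so this
    part of \<open>T\<close> already generates the ideal; minimality of \<open>T\<close> leaves
    nothing else in it.\<close>
  define T' where "T' = {B \<in> T. B \<in> S \<or> - B \<in> S}"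
  have "B \<in> ideal_gen T'" if "B \<in> S" for B
  proof -
    have "B \<in> T' \<or> - B \<in> T'"
      using in_T[OF that] that unfolding T'_def by auto
    then show ?thesis
      using ideal_base ideal_neg by (metis minus_minus)
  qed
  moreover have "T' \<subseteq> ideal_gen S"
    using T(1) ideal_base[of _ T] gen unfolding T'_def binomial_generating_system_def by blast
  ultimately have "ideal_gen T' = I"
    using ideal_gen_eqI[of S T'] gen by blast
  moreover have "T' \<subseteq> T"
    unfolding T'_def by blast
  ultimately have "T' = T"
    using T(2) unfolding minimal_generating_set_def by blast
  then have in_S: "B \<in> S \<or> - B \<in> S" if "B \<in> T" for B
    using that unfolding T'_def by blast
  show ?thesis
  proof (intro equalityI subsetI)
    fix X assume "X \<in> up_to_sign T"
    then obtain B where "B \<in> T" and X: "X = {B, - B}"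
      unfolding up_to_sign_def by blast
    then consider "B \<in> S" | "- B \<in> S"
      using in_S by blast
    then show "X \<in> up_to_sign S"
      unfolding X up_to_sign_def by cases (auto intro!: image_eqI[where x="- B"])
  next
    fix X assume "X \<in> up_to_sign S"
    then obtain B where "B \<in> S" and X: "X = {B, - B}"
      unfolding up_to_sign_def by blast
    then consider "B \<in> T" | "- B \<in> T"
      using in_T by blast
    then show "X \<in> up_to_sign T"
      unfolding X up_to_sign_def by cases (auto intro!: image_eqI[where x="- B"])
  qed
qed

text \<open>The assumption of a nonzero vector excludes a real exception: for a single zero vector
  the ideal \<open>(x - 1)\<close> is generic, yet \<open>x^2 - 1\<close> and \<open>x^3 - 1\<close>
  form a second minimal system.\<close>

theorem theorem3p1:
  fixes a :: "'m::finite \<Rightarrow> int ^ 'n"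
  assumes "pointed (semigroup_of a)"
    and "\<exists>i. a i \<noteq> 0"
    and "generic (toric_ideal a :: ('m, 'k::field) mpoly set)"
  shows "nu (toric_ideal a :: ('m, 'k) mpoly set) = 1 \<and>
    ideal_gen {B. indispensable (toric_ideal a) B} = (toric_ideal a :: ('m, 'k) mpoly set)"
proof -
  let ?I = "toric_ideal a :: ('m, 'k) mpoly set"
  obtain S where min: "minimal_generating_set ?I S" and full: "\<forall>B\<in>S. full_support_binomial B"
    using assms(3) unfolding generic_def by blast
  have gen: "ideal_gen S = ?I"
    using min unfolding minimal_generating_set_def by blast
  have ind: "\<forall>B\<in>S. indispensable ?I B"
    using generic_generator_indispensable[OF assms(1,2) min full] by blast
  have "binomial_generating_system ?I S"
    using ind gen unfolding binomial_generating_system_def indispensable_def by blast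
  then have "up_to_sign ` {T. binomial_generating_system ?I T \<and> minimal_generating_set ?I T}
      = {up_to_sign S}"
    using minimal_system_of_indispensables_unique[OF ind gen] min by blast
  then have "nu ?I = 1"
    unfolding nu_def by simp
  \<comment> \<open>The indispensable binomials lie between \<open>S\<close> and the ideal that
    \<open>S\<close> generates.\<close>
  moreover have "ideal_gen {B. indispensable ?I B} = ideal_gen S"
    by (rule ideal_gen_eqI) (use ind in \<open>auto simp: gen indispensable_def intro: ideal_base\<close>)
  ultimately show ?thesis
    using gen by simp
qed

end
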